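(* Let $\alpha,\beta$ be relatively prime positive integers, and let $f(x)=\sum_{k\ge1}a_kx^k$, where $a_k$ is the number of paths in $\mathcal{L}_{\beta/\alpha}(k)$ that are bounce-free with respect to the line $y=\frac{\beta}{\alpha}x$. Then, as formal power series, $$f(x)=\frac{g(x)+2\left(g_{en}(x)^2-g_{ee}(x)g_{nn}(x)\right)}{(1+g_{en}(x))^2-g_{ee}(x)g_{nn}(x)}.$$
   Context: For a positive integer $k$, $\mathcal{L}_{\beta/\alpha}(k)$ is the set of lattice paths from $(0,0)$ to $(\alpha k,\beta k)$ with unit East steps $E=(1,0)$ and unit North steps $N=(0,1)$. For $A,B\in\{E,N\}$, an $AB$-path is such a path whose first step is $A$ and whose last step is $B$. A left bounce of a path is an interior vertex of the path that lies on the line $y=\frac{\beta}{\alpha}x$ (hence is a point $(\alpha i,\beta i)$ with $0<i<k$) at which the path arrives by an $E$-step and leaves by an $N$-step; a right bounce is such a vertex at which the path arrives by an $N$-step and leaves by an $E$-step. A path is bounce-free if it has no left bounces and no right bounces. Generating functions of all paths: $g(x)=\sum_{k\ge1}\binom{(\alpha+\beta)k}{\alpha k}x^k$ counts all paths in $\mathcal{L}_{\beta/\alpha}(k)$, and $g_{ab}(x)$ counts $AB$-paths: $g_{ee}(x)=\sum_{k\ge1}\binom{(\alpha+\beta)k-2}{\alpha k-2}x^k$, $g_{en}(x)=g_{ne}(x)=\sum_{k\ge1}\binom{(\alpha+\beta)k-2}{\alpha k-1}x^k$, $g_{nn}(x)=\sum_{k\ge1}\binom{(\alpha+\beta)k-2}{\alpha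 k}x^k$, with $\binom{n}{m}=0$ if $m<0$ or $m>n$. *)

theory Defs
  imports Complex_Main "HOL-Computational_Algebra.Formal_Power_Series"
begin

datatype step = East | North

text \<open>A path starting at the origin is the list of its steps; its \<open>i\<close>-th vertex is the point
  reached after the first \<open>i\<close> steps.\<close>

definition vertex :: "step list \<Rightarrow> nat \<Rightarrow> nat \<times> nat" where
  "vertex p i = (count_list (take i p) East, count_list (take i p) North)"

definition lattice_paths :: "nat \<Rightarrow> nat \<Rightarrow> nat \<Rightarrow> step list set" where
  "lattice_paths \<alpha> \<beta> k = {p. vertex p (length p) = (\<alpha> * k, \<beta> * k)}"

definition on_line :: "nat \<Rightarrow> nat \<Rightarrow> nat \<times> nat \<Rightarrow> bool" where
  "on_line \<alpha> \<beta> P \<longleftrightarrow> real (snd P) = real \<beta> / real \<alpha> * real (fst P)"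

text \<open>The path arrives at its \<open>i\<close>-th vertex by the step \<open>p ! (i - 1)\<close> and leaves it by \<open>p ! i\<close>;
  the interior vertices are those with \<open>0 < i < length p\<close>.\<close>

definition left_bounce :: "nat \<Rightarrow> nat \<Rightarrow> step list \<Rightarrow> nat \<Rightarrow> bool" where
  "left_bounce \<alpha> \<beta> p i \<longleftrightarrow>
     0 < i \<and> i < length p \<and> on_line \<alpha> \<beta> (vertex p i) \<and> p ! (i - 1) = East \<and> p ! i = North"

definition right_bounce :: "nat \<Rightarrow> nat \<Rightarrow> step list \<Rightarrow> nat \<Rightarrow> bool" where
  "right_bounce \<alpha> \<beta> p i \<longleftrightarrow>
     0 < i \<and> i < length p \<and> on_line \<alpha> \<beta> (vertex p i) \<and> p ! (i - 1) = North \<and> p ! i = East"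

definition bounce_free :: "nat \<Rightarrow> nat \<Rightarrow> step list \<Rightarrow> bool" where
  "bounce_free \<alpha> \<beta> p \<longleftrightarrow> (\<nexists>i. left_bounce \<alpha> \<beta> p i) \<and> (\<nexists>i. right_bounce \<alpha> \<beta> p i)"

text \<open>The binomial coefficient with integer arguments that vanishes for \<open>m < 0\<close> and for \<open>m > n\<close>.
  Truncated subtraction on \<^typ>\<open>nat\<close> would give the wrong value \<open>1\<close> for \<open>\<alpha> k - 2\<close> when
  \<open>\<alpha> k = 1\<close>.\<close>

definition binom :: "int \<Rightarrow> int \<Rightarrow> nat" where
  "binom n m = (if m < 0 \<or> m > n then 0 else nat n choose nat m)"

definition fps_from_1 :: "(nat \<Rightarrow> nat) \<Rightarrow> rat fps" where
  "fps_from_1 c = Abs_fps (\<lambda>k. if k \<ge> 1 then of_nat (c k) else 0)"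

definition g_all :: "nat \<Rightarrow> nat \<Rightarrow> rat fps" where
  "g_all \<alpha> \<beta> = fps_from_1 (\<lambda>k. binom (int ((\<alpha> + \<beta>) * k)) (int (\<alpha> * k)))"

definition g_ee :: "nat \<Rightarrow> nat \<Rightarrow> rat fps" where
  "g_ee \<alpha> \<beta> = fps_from_1 (\<lambda>k. binom (int ((\<alpha> + \<beta>) * k) - 2) (int (\<alpha> * k) - 2))"

definition g_en :: "nat \<Rightarrow> nat \<Rightarrow> rat fps" where
  "g_en \<alpha> \<beta> = fps_from_1 (\<lambda>k. binom (int ((\<alpha> + \<beta>) * k) - 2) (int (\<alpha> * k) - 1))"

definition g_nn :: "nat \<Rightarrow> nat \<Rightarrow> rat fps" where
  "g_nn \<alpha> \<beta> = fps_from_1 (\<lambda>k. binom (int ((\<alpha> + \<beta>) * k) - 2) (int (\<alpha> * k)))"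

definition f_bounce_free :: "nat \<Rightarrow> nat \<Rightarrow> rat fps" where
  "f_bounce_free \<alpha> \<beta> = fps_from_1 (\<lambda>k. card {p \<in> lattice_paths \<alpha> \<beta> k. bounce_free \<alpha> \<beta> p})"

end

theory Submission
  imports Defs
begin

text \<open>Cutting an \<open>AB\<close>-path at its first bounce leaves a bounce-free path and an
  arbitrary path whose first step differs from the last step before the cut; coprimality puts the cut at a point
  \<open>(\<alpha> i, \<beta> i)\<close>. With \<open>f\<^sub>a\<^sub>b\<close> counting the bounce-free \<open>ab\<close>-paths,
  this reads \<open>G = F + F J G\<close> for the matrices \<open>G = (g\<^sub>a\<^sub>b)\<close>, \<open>F = (f\<^sub>a\<^sub>b)\<close> and \<open>J\<close> the swap of
  \<open>e\<close> and \<open>n\<close>. Hence \<open>F = G (1 + J G)\<^sup>-\<^sup>1\<close>, and \<open>f\<close> is the sum of the entries of \<open>F\<close>; the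
  denominator is \<open>det (1 + J G)\<close>.\<close>

section \<open>Words with prescribed numbers of steps\<close>

lemma UNIV_step: "(UNIV :: step set) = {East, North}"
  using step.exhaust by auto

instance step :: finite
  by standard (simp add: UNIV_step)

text \<open>Step counts replace endpoints because they are additive under \<open>#\<close> and
  \<open>@\<close>, which is what cutting and gluing paths needs.\<close>

definition words :: "nat \<Rightarrow> nat \<Rightarrow> step list set" where
  "words m l = {p. count_list p East = m \<and> count_list p North = l}"

lemma length_eq_count_steps: "length p = count_list p East + count_list p North"
proof (induction p)
  case (Cons s p)
  then show ?case by (cases s) auto
qed simp

lemma finite_words: "finite (words m l)"
proof (rule finite_subset)
  show "words m l \<subseteq> {p. set p \<subseteq> UNIV \<and> length p = m + l}"
    by (auto simp: words_def length_eq_count_steps)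
  show "finite {p. set p \<subseteq> (UNIV :: step set) \<and> length p = m + l}"
    by (rule finite_lists_length_eq) simp
qed

lemma words_0_0: "words 0 0 = {[]}"
proof -
  have "p = []" if "p \<in> words 0 0" for p
    using that length_eq_count_steps[of p] by (simp add: words_def)
  then show ?thesis by (auto simp: words_def)
qed

lemma words_0_left: "words 0 l = {replicate l North}"
proof (induction l)
  case 0
  show ?case by (simp add: words_0_0)
next
  case (Suc l)
  have "p = replicate (Suc l) North" if "p \<in> words 0 (Suc l)" for p
  proof (cases p)
    case Nil
    then show ?thesis using that by (simp add: words_def)
  next
    case (Cons s q)
    then have "s = North" "q \<in> words 0 l"
      using that by (cases s; auto simp: words_def)+
    then show ?thesis using Cons Suc by simp
  qed
  moreover have "replicate (Suc l) North \<in> words 0 (Suc l)"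
    using Suc by (auto simp: words_def)
  ultimately show ?case by blast
qed

lemma words_0_right: "words m 0 = {replicate m East}"
proof (induction m)
  case 0
  show ?case by (simp add: words_0_0)
next
  case (Suc m)
  have "p = replicate (Suc m) East" if "p \<in> words (Suc m) 0" for p
  proof (cases p)
    case Nil
    then show ?thesis using that by (simp add: words_def)
  next
    case (Cons s q)
    then have "s = East" "q \<in> words m 0"
      using that by (cases s; auto simp: words_def)+
    then show ?thesis using Cons Suc by simp
  qed
  moreover have "replicate (Suc m) East \<in> words (Suc m) 0"
    using Suc by (auto simp: words_def)
  ultimately show ?case by blast
qed

lemma words_Suc_Suc:
  "words (Suc m) (Suc l) = (#) East ` words m (Suc l) \<union> (#) North ` words (Suc m) l"
proof -
  have "p \<in> (#) East ` words m (Suc l) \<union> (#) North ` words (Suc m) l"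
    if "p \<in> words (Suc m) (Suc l)" for p
  proof (cases p)
    case Nil
    then show ?thesis using that by (simp add: words_def)
  next
    case (Cons s q)
    then show ?thesis using that by (cases s) (auto simp: words_def)
  qed
  then show ?thesis by (auto simp: words_def)
qed

lemma card_words: "card (words m l) = (m + l) choose m"
\<comment> \<open>Splitting by the first step is Pascal's rule. Either argument may be the one that
  drops, so the induction runs on the length.\<close>
proof (induction "m + l" arbitrary: m l)
  case 0
  then show ?case by (simp add: words_0_left)
next
  case (Suc n)
  show ?case
  proof (cases "m = 0 \<or> l = 0")
    case True
    then show ?thesis by (auto simp: words_0_left words_0_right)
  next
    case False
    then obtain m' l' where eq: "m = Suc m'" "l = Suc l'"
      by (meson not0_implies_Suc)
    have "card (words m l) = card ((#) East ` words m' l) + card ((#) North ` words m l')"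
      unfolding eq words_Suc_Suc
      by (rule card_Un_disjoint) (auto simp: finite_words)
    also have "\<dots> = card (words m' l) + card (words m l')"
      by (simp add: card_image)
    also have "\<dots> = (m' + l choose m') + (m + l' choose m)"
      using Suc.hyps eq by simp
    finally show ?thesis by (simp add: eq)
  qed
qed

section \<open>Paths with prescribed first and last steps\<close>

definition ab_paths :: "nat \<Rightarrow> nat \<Rightarrow> nat \<Rightarrow> step \<Rightarrow> step \<Rightarrow> step list set" where
  "ab_paths \<alpha> \<beta> k a b = {p \<in> lattice_paths \<alpha> \<beta> k. hd p = a \<and> last p = b}"

definition bf_paths :: "nat \<Rightarrow> nat \<Rightarrow> nat \<Rightarrow> step \<Rightarrow> step \<Rightarrow> step list set" where
  "bf_paths \<alpha> \<beta> k a b = {p \<in> ab_paths \<alpha> \<beta> k a b. bounce_free \<alpha> \<beta> p}"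

lemma lattice_paths_eq_words: "lattice_paths \<alpha> \<beta> k = words (\<alpha> * k) (\<beta> * k)"
  by (auto simp: lattice_paths_def words_def vertex_def)

lemma finite_ab_paths: "finite (ab_paths \<alpha> \<beta> k a b)"
  by (simp add: ab_paths_def lattice_paths_eq_words finite_words)

lemma finite_bf_paths: "finite (bf_paths \<alpha> \<beta> k a b)"
  by (simp add: bf_paths_def finite_ab_paths)

lemma length_lattice_path: "p \<in> lattice_paths \<alpha> \<beta> k \<Longrightarrow> length p = (\<alpha> + \<beta>) * k"
  by (simp add: lattice_paths_eq_words words_def length_eq_count_steps algebra_simps)

text \<open>The four end classes partition the paths for every \<open>k\<close>: even the empty path
  falls into exactly one, since \<open>hd []\<close> and \<open>last []\<close> are fixed, if
  unspecified. \<open>Q\<close> will be bounce-freeness for \<open>f\<close> and \<open>True\<close>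
  for \<open>g\<close>.\<close>

lemma card_lattice_paths_by_ends:
  "card {p \<in> lattice_paths \<alpha> \<beta> k. Q p} =
    (\<Sum>a\<in>UNIV. \<Sum>b\<in>UNIV. card {p \<in> ab_paths \<alpha> \<beta> k a b. Q p})"
proof -
  have "{p \<in> lattice_paths \<alpha> \<beta> k. Q p} =
      (\<Union>(a, b)\<in>UNIV. {p \<in> ab_paths \<alpha> \<beta> k a b. Q p})"
    by (auto simp: ab_paths_def)
  also have "card \<dots> = (\<Sum>(a, b)\<in>UNIV. card {p \<in> ab_paths \<alpha> \<beta> k a b. Q p})"
    by (subst card_UN_disjoint)
      (auto simp: finite_ab_paths case_prod_unfold ab_paths_def lattice_paths_eq_words finite_words)
  finally show ?thesis
    by (simp add: sum.cartesian_product UNIV_Times_UNIV)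
qed

text \<open>Stripping the two prescribed end steps leaves an arbitrary word. Both step counts being
  positive, the path has at least two steps, so its ends are different positions.\<close>

lemma card_ab_paths:
  assumes "0 < \<alpha> * k" "0 < \<beta> * k"
  shows "card (ab_paths \<alpha> \<beta> k a b) = binom (int ((\<alpha> + \<beta>) * k) - 2)
    (int (\<alpha> * k) - (if a = East then 1 else 0) - (if b = East then 1 else 0))"
proof -
  define e n :: nat where "e = count_list [a, b] East" and "n = count_list [a, b] North"
  have en: "e + n = 2"
    unfolding e_def n_def by (cases a; cases b) auto
  have ends: "int (\<alpha> * k) - (if a = East then 1 else 0) - (if b = East then 1 else 0)
      = int (\<alpha> * k) - int e"
    unfolding e_def by (cases a; cases b) auto
  \<comment> \<open>The counts are stated by addition, so that the set is empty, not wrong by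
    truncation, when the ends use more steps of a kind than the path has.\<close>
  have ab: "ab_paths \<alpha> \<beta> k a b =
      (\<lambda>w. a # w @ [b]) ` {w. count_list w East + e = \<alpha> * k \<and> count_list w North + n = \<beta> * k}"
    (is "_ = ?h ` ?W")
  proof (intro equalityI subsetI)
    fix p assume p: "p \<in> ab_paths \<alpha> \<beta> k a b"
    then have "length p = \<alpha> * k + \<beta> * k"
      using length_lattice_path[of p \<alpha> \<beta> k] by (simp add: ab_paths_def algebra_simps)
    then have "2 \<le> length p" using assms by linarith
    then obtain s w t where w: "p = s # w @ [t]"
      by (cases p; cases "tl p" rule: rev_cases) auto
    with p have "s = a" "t = b" by (auto simp: ab_paths_def)
    with p w show "p \<in> ?h ` ?W"
      by (auto simp: ab_paths_def lattice_paths_eq_words words_def e_def n_def)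
  next
    fix p assume "p \<in> ?h ` ?W"
    then show "p \<in> ab_paths \<alpha> \<beta> k a b"
      by (auto simp: ab_paths_def lattice_paths_eq_words words_def e_def n_def)
  qed
  have "inj_on ?h ?W" by (auto intro: inj_onI)
  then have card: "card (ab_paths \<alpha> \<beta> k a b) = card ?W"
    by (simp add: ab card_image)
  show ?thesis
  proof (cases "e \<le> \<alpha> * k \<and> n \<le> \<beta> * k")
    case True
    then have "?W = words (\<alpha> * k - e) (\<beta> * k - n)"
      by (auto simp: words_def)
    moreover have "int ((\<alpha> + \<beta>) * k) - 2 = int ((\<alpha> * k - e) + (\<beta> * k - n))"
      using True en by (simp add: algebra_simps of_nat_diff)
    moreover have "int (\<alpha> * k) - int e = int (\<alpha> * k - e)"
      using True by simp
    ultimately show ?thesis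
      unfolding card ends by (simp only: card_words binom_def nat_int) simp
  next
    case False
    then have "?W = {}" by auto
    \<comment> \<open>The upper index minus the lower one is \<open>\<beta> * k - n\<close> over the
      integers. So too many East ends make the lower index negative, and too many North ends push it
      above the upper one; \<open>binom\<close> is 0 in both cases.\<close>
    moreover have "int (\<alpha> * k) - int e < 0
        \<or> int (\<alpha> * k) - int e > int ((\<alpha> + \<beta>) * k) - 2"
      using False en unfolding distrib_right of_nat_add by linarith
    ultimately show ?thesis unfolding card ends by (simp only: binom_def) simp
  qed
qed

lemma card_lattice_paths: "card (lattice_paths \<alpha> \<beta> k) = binom (int ((\<alpha> + \<beta>) * k)) (int (\<alpha> * k))"
  unfolding lattice_paths_eq_words card_words binom_def distrib_right nat_int
  by (simp del: of_nat_mult)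

section \<open>Decomposition at the first bounce\<close>

text \<open>Left and right bounces are merged: the decomposition only uses that the two steps
  meeting on the line differ.\<close>

definition bounce :: "nat \<Rightarrow> nat \<Rightarrow> step list \<Rightarrow> nat \<Rightarrow> bool" where
  "bounce \<alpha> \<beta> p i \<longleftrightarrow>
    0 < i \<and> i < length p \<and> on_line \<alpha> \<beta> (vertex p i) \<and> p ! (i - 1) \<noteq> p ! i"

lemma bounce_free_iff: "bounce_free \<alpha> \<beta> p \<longleftrightarrow> (\<forall>i. \<not> bounce \<alpha> \<beta> p i)"
proof -
  have "s \<noteq> t \<longleftrightarrow> s = East \<and> t = North \<or> s = North \<and> t = East" for s t
    by (cases s; cases t) auto
  then show ?thesis
    unfolding bounce_free_def left_bounce_def right_bounce_def bounce_def by blast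
qed

text \<open>Steps \<open>i - 1\<close> and \<open>i\<close> both lie in \<open>q\<close>. The bound
  is strict because at \<open>i = length q\<close> the outgoing step belongs to
  \<open>r\<close>.\<close>

lemma bounce_append_left:
  "i < length q \<Longrightarrow> bounce \<alpha> \<beta> (q @ r) i \<longleftrightarrow> bounce \<alpha> \<beta> q i"
  by (auto simp: bounce_def vertex_def nth_append)

lemma on_line_iff:
  assumes "\<alpha> > 0" "coprime \<alpha> \<beta>"
  shows "on_line \<alpha> \<beta> P \<longleftrightarrow> (\<exists>i. P = (\<alpha> * i, \<beta> * i))"
proof
  obtain x y where P: "P = (x, y)" by fastforce
  assume "on_line \<alpha> \<beta> P"
  then have "real \<alpha> * real y = real \<beta> * real x"
    using assms(1) by (simp add: on_line_def P field_simps)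
  then have eq: "\<alpha> * y = \<beta> * x" by (metis of_nat_eq_iff of_nat_mult)
  then have "\<alpha> dvd \<beta> * x" by (metis dvd_triv_left)
  \<comment> \<open>Coprimality enters here: every lattice point on the line is the endpoint of some
    \<open>lattice_paths \<alpha> \<beta> i\<close>.\<close>
  then have "\<alpha> dvd x" using assms(2) by (simp add: coprime_dvd_mult_right_iff)
  then obtain i where i: "x = \<alpha> * i" ..
  then have "y = \<beta> * i" using eq assms(1) by simp
  with i P show "\<exists>i. P = (\<alpha> * i, \<beta> * i)" by blast
next
  assume "\<exists>i. P = (\<alpha> * i, \<beta> * i)"
  then show "on_line \<alpha> \<beta> P" using assms(1) by (auto simp: on_line_def)
qed

lemma bounce_append_length:
  assumes "\<alpha> > 0" "coprime \<alpha> \<beta>" "q \<in> lattice_paths \<alpha> \<beta> i" "q \<noteq> []" "r \<noteq> []" "last q \<noteq> hd r"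
  shows "bounce \<alpha> \<beta> (q @ r) (length q)"
  using assms on_line_iff[OF assms(1,2)]
  by (auto simp: bounce_def vertex_def lattice_paths_def nth_append last_conv_nth hd_conv_nth)

text \<open>The swap \<open>J\<close> of the matrix equation: after a last step \<open>c\<close> on
  the line, \<open>flip c\<close> is the one next step that makes a bounce.\<close>

fun flip :: "step \<Rightarrow> step" where
  "flip East = North"
| "flip North = East"

lemma flip_eq_iff: "flip s = t \<longleftrightarrow> s \<noteq> t"
  by (cases s; cases t) auto

text \<open>Gluing creates a bounce at the seam, and it is the first one because \<open>q\<close>
  has none; so the cut can be recovered. Conversely, a path is cut at its least bounce. Bounces are
  interior, hence \<open>1 \<le> i < k\<close>.\<close>

lemma first_bounce_decomposition:
  assumes \<alpha>: "\<alpha> > 0" and co: "coprime \<alpha> \<beta>"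
  shows "bij_betw (\<lambda>(_, q, r). q @ r)
    (SIGMA (i, c):{1..<k} \<times> UNIV. bf_paths \<alpha> \<beta> i a c \<times> ab_paths \<alpha> \<beta> (k - i) (flip c) b)
    {p \<in> ab_paths \<alpha> \<beta> k a b. \<not> bounce_free \<alpha> \<beta> p}"
    (is "bij_betw ?h ?T ?S")
proof -
  have T: "x \<in> ?T \<longleftrightarrow> (\<exists>i c q r. x = ((i, c), q, r) \<and> 0 < i \<and> i < k
      \<and> q \<in> bf_paths \<alpha> \<beta> i a c \<and> r \<in> ab_paths \<alpha> \<beta> (k - i) (flip c) b)" for x
    by (cases x) auto
  have nonempty: "p \<noteq> []" if "p \<in> ab_paths \<alpha> \<beta> j s t" "0 < j" for p j s t
    using length_lattice_path[of p \<alpha> \<beta> j] that \<alpha> by (auto simp: ab_paths_def)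
  have cut: "bounce \<alpha> \<beta> (q @ r) (length q)"
    if "q \<in> bf_paths \<alpha> \<beta> i a c" "r \<in> ab_paths \<alpha> \<beta> (k - i) (flip c) b" "0 < i" "i < k" for q r i c
  proof (rule bounce_append_length[OF \<alpha> co])
    show "q \<in> lattice_paths \<alpha> \<beta> i" using that by (simp add: bf_paths_def ab_paths_def)
    show "q \<noteq> []" using that nonempty by (auto simp: bf_paths_def)
    show "r \<noteq> []" using that nonempty[of r "k - i"] by simp
    show "last q \<noteq> hd r"
      using that flip_eq_iff[of c "hd r"] by (auto simp: bf_paths_def ab_paths_def)
  qed
  \<comment> \<open>If \<open>q'\<close> were longer, the seam after \<open>q\<close> would be a
    bounce strictly inside the bounce-free \<open>q'\<close>. Using this in both directions gives
    injectivity.\<close>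
  have no_longer: "length q' \<le> length q"
    if "q @ r = q' @ r'" "bounce \<alpha> \<beta> (q @ r) (length q)" "bounce_free \<alpha> \<beta> q'" for q r q' r'
    using that bounce_append_left[of "length q" q' \<alpha> \<beta> r']
    by (auto simp: bounce_free_iff simp flip: not_less)
  show ?thesis
  proof (rule bij_betw_imageI)
    show "inj_on ?h ?T"
    proof (rule inj_onI)
      fix x y assume x: "x \<in> ?T" and y: "y \<in> ?T" and eq: "?h x = ?h y"
      from x obtain i c q r where x': "x = ((i, c), q, r)" "0 < i" "i < k"
        "q \<in> bf_paths \<alpha> \<beta> i a c" "r \<in> ab_paths \<alpha> \<beta> (k - i) (flip c) b" unfolding T by blast
      from y obtain i' c' q' r' where y': "y = ((i', c'), q', r')" "0 < i'" "i' < k"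
        "q' \<in> bf_paths \<alpha> \<beta> i' a c'" "r' \<in> ab_paths \<alpha> \<beta> (k - i') (flip c') b" unfolding T by blast
      have eq': "q @ r = q' @ r'" using eq x'(1) y'(1) by simp
      have "bounce_free \<alpha> \<beta> q" "bounce_free \<alpha> \<beta> q'"
        using x' y' by (auto simp: bf_paths_def)
      then have "length q = length q'"
        using no_longer[OF eq'] no_longer[OF eq'[symmetric]] cut x' y' by (metis le_antisym)
      then have qr: "q = q'" "r = r'" using eq' by auto
      have "c = c'" using qr x' y' by (auto simp: bf_paths_def ab_paths_def)
      \<comment> \<open>The index \<open>i\<close> is determined by the length of \<open>q\<close>,
        as \<open>\<alpha> + \<beta>\<close> is positive.\<close>
      moreover have "(\<alpha> + \<beta>) * i = (\<alpha> + \<beta>) * i'"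
        using length_lattice_path[of q \<alpha> \<beta> i] length_lattice_path[of q \<alpha> \<beta> i'] x' y' qr
        by (auto simp: bf_paths_def ab_paths_def)
      ultimately show "x = y" using qr x'(1) y'(1) \<alpha> by simp
    qed
    show "?h ` ?T = ?S"
    proof (intro equalityI subsetI)
      fix p assume "p \<in> ?h ` ?T"
      then obtain x where "x \<in> ?T" "p = ?h x" by blast
      then obtain i c q r where x': "p = q @ r" "0 < i" "i < k"
        "q \<in> bf_paths \<alpha> \<beta> i a c" "r \<in> ab_paths \<alpha> \<beta> (k - i) (flip c) b" unfolding T by auto
      have ne: "q \<noteq> []" "r \<noteq> []"
        using nonempty[of q i a c] nonempty[of r "k - i"] x' by (auto simp: bf_paths_def)
      \<comment> \<open>Needed for \<open>j = \<alpha>\<close> and \<open>j = \<beta>\<close>: the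
        step counts of the two pieces add up to those of \<open>p\<close>.\<close>
      have "j * i + j * (k - i) = j * k" for j
        using x'(3) by (simp flip: distrib_left)
      then have "p \<in> ab_paths \<alpha> \<beta> k a b"
        using x' ne by (auto simp: bf_paths_def ab_paths_def lattice_paths_eq_words words_def)
      moreover have "\<not> bounce_free \<alpha> \<beta> p"
        using cut[OF x'(4,5,2,3)] x'(1) by (auto simp: bounce_free_iff)
      ultimately show "p \<in> ?S" by simp
    next
      fix p assume p: "p \<in> ?S"
      then obtain j0 where "bounce \<alpha> \<beta> p j0" by (auto simp: bounce_free_iff)
      define j where "j = (LEAST j. bounce \<alpha> \<beta> p j)"
      have j: "bounce \<alpha> \<beta> p j" unfolding j_def by (rule LeastI) fact
      then have j': "0 < j" "j < length p" by (auto simp: bounce_def)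
      define q r where "q = take j p" and "r = drop j p"
      have pqr: "p = q @ r" and len: "length q = j" and ne: "q \<noteq> []" "r \<noteq> []"
        using j' by (auto simp: q_def r_def)
      obtain i where i: "vertex p j = (\<alpha> * i, \<beta> * i)"
        using j on_line_iff[OF \<alpha> co] by (auto simp: bounce_def)
      then have q: "q \<in> lattice_paths \<alpha> \<beta> i"
        by (simp add: q_def lattice_paths_eq_words words_def vertex_def)
      have "0 < i" using length_lattice_path[OF q] len j' by (cases i) auto
      have pL: "p \<in> lattice_paths \<alpha> \<beta> k" using p by (simp add: ab_paths_def)
      have "i < k"
        using length_lattice_path[OF q] length_lattice_path[OF pL] len j' by simp
      have "r \<in> lattice_paths \<alpha> \<beta> (k - i)"
        using pL q pqr by (auto simp: lattice_paths_eq_words words_def diff_mult_distrib2)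
      moreover have "hd r = flip (last q)"
        using j ne len flip_eq_iff[of "last q" "hd r"]
        by (auto simp: bounce_def pqr nth_append last_conv_nth hd_conv_nth)
      ultimately have "r \<in> ab_paths \<alpha> \<beta> (k - i) (flip (last q)) b"
        using p pqr ne by (auto simp: ab_paths_def)
      \<comment> \<open>A bounce of \<open>q\<close> would be a bounce of \<open>p\<close> before
        \<open>j\<close>, against the minimality of \<open>j\<close>.\<close>
      moreover have "\<not> bounce \<alpha> \<beta> q l" for l
      proof
        assume l: "bounce \<alpha> \<beta> q l"
        then have "l < j" using len by (auto simp: bounce_def)
        then show False
          using l bounce_append_left[of l q \<alpha> \<beta> r] len pqr not_less_Least[of l] j_def by metis
      qed
      then have "q \<in> bf_paths \<alpha> \<beta> i a (last q)"
        using p pqr ne q by (auto simp: bf_paths_def ab_paths_def bounce_free_iff)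
      ultimately have "((i, last q), q, r) \<in> ?T"
        using \<open>0 < i\<close> \<open>i < k\<close> unfolding T by blast
      then show "p \<in> ?h ` ?T" using pqr by (force intro: rev_image_eqI)
    qed
  qed
qed

lemma card_ab_paths_first_bounce:
  assumes "\<alpha> > 0" "coprime \<alpha> \<beta>"
  shows "card (ab_paths \<alpha> \<beta> k a b) = card (bf_paths \<alpha> \<beta> k a b) +
    (\<Sum>i=1..<k. \<Sum>c\<in>UNIV. card (bf_paths \<alpha> \<beta> i a c) * card (ab_paths \<alpha> \<beta> (k - i) (flip c) b))"
proof -
  have "ab_paths \<alpha> \<beta> k a b = bf_paths \<alpha> \<beta> k a b \<union> {p \<in> ab_paths \<alpha> \<beta> k a b. \<not> bounce_free \<alpha> \<beta> p}"
    by (auto simp: bf_paths_def)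
  then have "card (ab_paths \<alpha> \<beta> k a b) = card (bf_paths \<alpha> \<beta> k a b)
      + card {p \<in> ab_paths \<alpha> \<beta> k a b. \<not> bounce_free \<alpha> \<beta> p}"
    by (subst card_Un_disjoint[symmetric])
      (auto simp: finite_ab_paths finite_bf_paths bf_paths_def)
  also have "card {p \<in> ab_paths \<alpha> \<beta> k a b. \<not> bounce_free \<alpha> \<beta> p} =
      card (SIGMA (i, c):{1..<k} \<times> UNIV. bf_paths \<alpha> \<beta> i a c \<times> ab_paths \<alpha> \<beta> (k - i) (flip c) b)"
    using bij_betw_same_card[OF first_bounce_decomposition[OF assms]] by metis
  also have "\<dots> = (\<Sum>(i, c)\<in>{1..<k} \<times> UNIV.
      card (bf_paths \<alpha> \<beta> i a c) * card (ab_paths \<alpha> \<beta> (k - i) (flip c) b))"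
    by (subst card_SigmaI)
      (auto simp: finite_ab_paths finite_bf_paths case_prod_unfold card_cartesian_product)
  finally show ?thesis by (simp add: sum.cartesian_product)
qed

section \<open>Generating functions\<close>

definition ab_gf :: "nat \<Rightarrow> nat \<Rightarrow> step \<Rightarrow> step \<Rightarrow> rat fps" where
  "ab_gf \<alpha> \<beta> a b = fps_from_1 (\<lambda>k. card (ab_paths \<alpha> \<beta> k a b))"

definition bf_gf :: "nat \<Rightarrow> nat \<Rightarrow> step \<Rightarrow> step \<Rightarrow> rat fps" where
  "bf_gf \<alpha> \<beta> a b = fps_from_1 (\<lambda>k. card (bf_paths \<alpha> \<beta> k a b))"

lemma fps_from_1_nth: "fps_nth (fps_from_1 c) k = (if k \<ge> 1 then of_nat (c k) else 0)"
  by (simp add: fps_from_1_def)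

text \<open>The constant terms vanish, so the convolution runs over exactly the cut positions
  \<open>1 \<le> i < k\<close>.\<close>

lemma fps_from_1_mult_nth:
  "fps_nth (fps_from_1 c * fps_from_1 d) k = of_nat (\<Sum>i=1..<k. c i * d (k - i))"
proof -
  have "fps_nth (fps_from_1 c * fps_from_1 d) k
      = (\<Sum>i=0..k. fps_nth (fps_from_1 c) i * fps_nth (fps_from_1 d) (k - i))"
    by (rule fps_mult_nth)
  also have "\<dots> = (\<Sum>i=1..<k. fps_nth (fps_from_1 c) i * fps_nth (fps_from_1 d) (k - i))"
    by (rule sum.mono_neutral_right) (auto simp: fps_from_1_nth)
  also have "\<dots> = of_nat (\<Sum>i=1..<k. c i * d (k - i))"
    by (auto simp: fps_from_1_nth intro!: sum.cong)
  finally show ?thesis .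
qed

text \<open>Entry \<open>(a, b)\<close> of \<open>G = F + F J G\<close>; the swap pairs a piece
  ending in East with one starting in North, and vice versa.\<close>

lemma ab_gf_first_bounce:
  assumes "\<alpha> > 0" "coprime \<alpha> \<beta>"
  shows "ab_gf \<alpha> \<beta> a b = bf_gf \<alpha> \<beta> a b
    + bf_gf \<alpha> \<beta> a East * ab_gf \<alpha> \<beta> North b + bf_gf \<alpha> \<beta> a North * ab_gf \<alpha> \<beta> East b"
proof (rule fps_ext)
  fix k
  show "fps_nth (ab_gf \<alpha> \<beta> a b) k = fps_nth (bf_gf \<alpha> \<beta> a b
    + bf_gf \<alpha> \<beta> a East * ab_gf \<alpha> \<beta> North b + bf_gf \<alpha> \<beta> a North * ab_gf \<alpha> \<beta> East b) k"
    unfolding ab_gf_def bf_gf_def fps_add_nth fps_from_1_mult_nth fps_from_1_nth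
    by (simp add: card_ab_paths_first_bounce[OF assms, of k a b] UNIV_step sum.distrib)
qed

lemma f_bounce_free_eq:
  "f_bounce_free \<alpha> \<beta> = bf_gf \<alpha> \<beta> East East + bf_gf \<alpha> \<beta> East North
    + bf_gf \<alpha> \<beta> North East + bf_gf \<alpha> \<beta> North North"
  by (rule fps_ext)
    (simp add: f_bounce_free_def bf_gf_def fps_from_1_nth card_lattice_paths_by_ends UNIV_step
      bf_paths_def)

lemma g_all_eq:
  "g_all \<alpha> \<beta> = ab_gf \<alpha> \<beta> East East + ab_gf \<alpha> \<beta> East North
    + ab_gf \<alpha> \<beta> North East + ab_gf \<alpha> \<beta> North North"
  unfolding g_all_def card_lattice_paths[symmetric]
  using card_lattice_paths_by_ends[of \<alpha> \<beta> _ "\<lambda>_. True"]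
  by (intro fps_ext) (simp add: ab_gf_def fps_from_1_nth UNIV_step)

lemma ab_gf_eq:
  assumes "\<alpha> > 0" "\<beta> > 0"
  shows "ab_gf \<alpha> \<beta> East East = g_ee \<alpha> \<beta>" "ab_gf \<alpha> \<beta> East North = g_en \<alpha> \<beta>"
    "ab_gf \<alpha> \<beta> North East = g_en \<alpha> \<beta>" "ab_gf \<alpha> \<beta> North North = g_nn \<alpha> \<beta>"
  using assms
  by (auto intro!: fps_ext
      simp: ab_gf_def g_ee_def g_en_def g_nn_def fps_from_1_nth card_ab_paths)

theorem corollary2p4:
  fixes \<alpha> \<beta> :: nat
  assumes "\<alpha> > 0" and "\<beta> > 0" and "coprime \<alpha> \<beta>"
  shows "f_bounce_free \<alpha> \<beta> =
    (g_all \<alpha> \<beta> + 2 * ((g_en \<alpha> \<beta>)^2 - g_ee \<alpha> \<beta> * g_nn \<alpha> \<beta>)) /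
    ((1 + g_en \<alpha> \<beta>)^2 - g_ee \<alpha> \<beta> * g_nn \<alpha> \<beta>)"
proof -
  define ee en nn where "ee = g_ee \<alpha> \<beta>" and "en = g_en \<alpha> \<beta>" and "nn = g_nn \<alpha> \<beta>"
  \<comment> \<open>\<open>J G\<close> has rows \<open>(en, nn)\<close> and \<open>(ee, en)\<close>,
    so \<open>D\<close> is the determinant of \<open>1 + J G\<close>.\<close>
  define D where "D = (1 + en)^2 - ee * nn"
  note gf = ab_gf_eq[OF assms(1,2), folded ee_def en_def nn_def]
  \<comment> \<open>Row sums of \<open>F D = G adj(1 + J G)\<close>: the factors on the right are
    the row sums of the adjugate, whose rows are \<open>(1 + en, - nn)\<close> and
    \<open>(- ee, 1 + en)\<close>. Substituting the first-bounce equations turns the claim into a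
    polynomial identity.\<close>
  have row: "(bf_gf \<alpha> \<beta> a East + bf_gf \<alpha> \<beta> a North) * D =
      ab_gf \<alpha> \<beta> a East * (1 + en - nn) + ab_gf \<alpha> \<beta> a North * (1 + en - ee)" for a
    unfolding ab_gf_first_bounce[OF assms(1,3), of a East]
      ab_gf_first_bounce[OF assms(1,3), of a North] gf D_def
    by (simp add: algebra_simps power2_eq_square)
  have "f_bounce_free \<alpha> \<beta> * D = (bf_gf \<alpha> \<beta> East East + bf_gf \<alpha> \<beta> East North) * D
      + (bf_gf \<alpha> \<beta> North East + bf_gf \<alpha> \<beta> North North) * D"
    unfolding f_bounce_free_eq by (simp add: algebra_simps)
  also have "\<dots> = (ee * (1 + en - nn) + en * (1 + en - ee))
      + (en * (1 + en - nn) + nn * (1 + en - ee))"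
    unfolding row gf ..
  also have "\<dots> = g_all \<alpha> \<beta> + 2 * (en^2 - ee * nn)"
    unfolding g_all_eq gf by (simp add: algebra_simps power2_eq_square)
  finally have "f_bounce_free \<alpha> \<beta> * D = g_all \<alpha> \<beta> + 2 * (en^2 - ee * nn)" .
  \<comment> \<open>\<open>ee\<close> and \<open>en\<close> have no constant term. Hence
    \<open>D\<close> is nonzero and can be cancelled, which makes the quotient of power series
    exact.\<close>
  moreover have "fps_nth D 0 = 1"
    by (simp add: D_def ee_def en_def nn_def g_ee_def g_en_def fps_from_1_nth power2_eq_square)
  then have "D \<noteq> 0" by auto
  ultimately have "f_bounce_free \<alpha> \<beta> = (g_all \<alpha> \<beta> + 2 * (en^2 - ee * nn)) / D"
    by (metis nonzero_mult_div_cancel_right)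
  then show ?thesis by (simp only: D_def ee_def en_def nn_def)
qed

end
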